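(* Assume that $\{Z_i\}_{i=-\infty}^{\infty}$ is a stationary and ergodic sequence of $\mathbb{R}^k$-valued random vectors, and denote by $\mu$ the distribution of $Z_1$. Let $F:\mathbb{R}^d\times\mathbb{R}^k\to\mathbb{R}^d$ be measurable. Suppose that $$\int |F(0,z)|\,\mu(dz)<\infty,$$ and that there is a (measurable) function $z\mapsto K_z\in[0,\infty)$ on $\mathbb{R}^k$ such that $$|F(x,z)-F(x',z)|\le K_z|x-x'|\quad\text{for all }x,x'\in\mathbb{R}^d,\ z\in\mathbb{R}^k,$$ with $$\mathbb{E}\{\log K_{Z_1}\}<0.$$ Then the class $\{X_n(v),\ v\in\mathbb{R}^d\}$ defined by $X_0(v)=v$, $X_{n+1}(v)=F(X_n(v),Z_{n+1})$ for $n\ge0$, is strongly stable.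
   Context: $|\cdot|$ is the Euclidean norm on $\mathbb{R}^d$. For a random vector $V$ in $\mathbb{R}^d$ (defined on the same probability space as $\{Z_i\}$, and allowed to depend on the entire trajectory of $\{Z_i\}$), $X_n(V)$ denotes the process defined by the recursion with $X_0=V$. Definition (strong stability). The class $\{X_n(v),\ v\in\mathbb{R}^d\}$ is called strongly stable if (I) there exists a random vector $V^*$ such that $\{X_i(V^* )\}_{i=0}^{\infty}$ is stationary and ergodic, and (II) for any random vector $V$, $X_n(V)-X_n(V^* )\to 0$ almost surely as $n\to\infty$. *)

theory Defs
  imports "HOL-Probability.Probability"
begin

abbreviation path_space :: "('i \<Rightarrow> 'b::topological_space) measure" where
  "path_space \<equiv> (\<Pi>\<^sub>M i\<in>UNIV. borel)"

definition path_law :: "'a measure \<Rightarrow> ('i \<Rightarrow> 'a \<Rightarrow> 'b::topological_space) \<Rightarrow> ('i \<Rightarrow> 'b) measure" where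
  "path_law M Y = distr M path_space (\<lambda>\<omega> i. Y i \<omega>)"

(* The index type is int for two-sided and nat for one-sided processes. *)

definition stationary :: "'a measure \<Rightarrow> ('i::semiring_1 \<Rightarrow> 'a \<Rightarrow> 'b::topological_space) \<Rightarrow> bool" where
  "stationary M Y \<longleftrightarrow>
     (\<forall>i. Y i \<in> borel_measurable M) \<and>
     (\<forall>h. path_law M (\<lambda>i. Y (i + h)) = path_law M Y)"

definition shift :: "('i::semiring_1 \<Rightarrow> 'b) \<Rightarrow> 'i \<Rightarrow> 'b" where
  "shift w = (\<lambda>i. w (i + 1))"

(* The space of path_space is all of UNIV, so the preimage below needs no relativisation. *)

definition stationary_ergodic :: "'a measure \<Rightarrow> ('i::semiring_1 \<Rightarrow> 'a \<Rightarrow> 'b::topological_space) \<Rightarrow> bool" where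
  "stationary_ergodic M Y \<longleftrightarrow>
     stationary M Y \<and>
     (\<forall>A \<in> sets path_space. shift -` A = A \<longrightarrow>
        measure (path_law M Y) A = 0 \<or> measure (path_law M Y) A = 1)"

primrec driven_process :: "('b \<Rightarrow> 'c \<Rightarrow> 'b) \<Rightarrow> (int \<Rightarrow> 'a \<Rightarrow> 'c) \<Rightarrow> ('a \<Rightarrow> 'b) \<Rightarrow> nat \<Rightarrow> 'a \<Rightarrow> 'b" where
  "driven_process F Z V 0 = V"
| "driven_process F Z V (Suc n) = (\<lambda>\<omega>. F (driven_process F Z V n \<omega>) (Z (int n + 1) \<omega>))"

(* X maps an initial random vector V to the process X_n(V). The vector V is any measurable
   function on the underlying probability space, with no independence assumption. *)

definition strongly_stable ::
  "'a measure \<Rightarrow> (('a \<Rightarrow> 'b::real_normed_vector) \<Rightarrow> nat \<Rightarrow> 'a \<Rightarrow> 'b) \<Rightarrow> bool" where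
  "strongly_stable M X \<longleftrightarrow>
     (\<exists>V' \<in> borel_measurable M.
        stationary_ergodic M (X V') \<and>
        (\<forall>V \<in> borel_measurable M.
           AE \<omega> in M. (\<lambda>n. X V n \<omega> - X V' n \<omega>) \<longlonglongrightarrow> 0))"

(* Logarithm on [0,\<infinity>) with log 0 = -\<infinity>, as opposed to ln 0 = 0 in the library. *)

definition elog :: "real \<Rightarrow> ereal" where
  "elog x = (if x = 0 then -\<infinity> else ereal (ln x))"

(* Expectation E f^+ - E f^- with values in [-\<infinity>,\<infinity>]; e2ennreal sends negative
   arguments to 0. If both parts are infinite, the value is \<infinity> - \<infinity> = \<infinity>
   in ereal; so eexpectation M f < 0 implies that the expectation is well defined. *)

definition eexpectation :: "'a measure \<Rightarrow> ('a \<Rightarrow> ereal) \<Rightarrow> ereal" where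
  "eexpectation M f =
     enn2ereal (\<integral>\<^sup>+ \<omega>. e2ennreal (f \<omega>) \<partial>M) - enn2ereal (\<integral>\<^sup>+ \<omega>. e2ennreal (- f \<omega>) \<partial>M)"

end

theory Submission
  imports Defs
begin

text \<open>Truncating \<open>K\<close> away from \<open>0\<close>, we may assume that \<open>log K\<close> is integrable with negative mean. The
  maximal ergodic theorem, applied to the shift and to its inverse on the path space of \<open>Z\<close>, shows that
  the products of \<open>K\<close> along the path decay geometrically in both time directions. Backward in time
  this, together with the integrability of \<open>F 0\<close>, makes the iterates started from \<open>0\<close> in the distant
  past converge to a measurable function of the path, which gives \<open>V\<^sup>*\<close>. The process started
  from it is a stationary coding of \<open>Z\<close>, hence stationary and ergodic. Forward in time the decay
  makes any two solutions merge.\<close>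

section \<open>Running maxima of Birkhoff sums\<close>

text \<open>In closed form this is the maximum over 0 \<le> k \<le> n of the Birkhoff sums
  \<open>\<Sum>i<k. f ((T ^^ i) x)\<close>. The recursive form exposes the relation between the
  values at \<open>x\<close> and at \<open>T x\<close>.\<close>

primrec running_max :: "('a \<Rightarrow> 'a) \<Rightarrow> ('a \<Rightarrow> real) \<Rightarrow> nat \<Rightarrow> 'a \<Rightarrow> real" where
  "running_max T f 0 x = 0"
| "running_max T f (Suc n) x = max 0 (f x + running_max T f n (T x))"

lemma running_max_nonneg: "0 \<le> running_max T f n x"
  by (cases n) auto

lemma running_max_mono: "running_max T f n x \<le> running_max T f (Suc n) x"
proof (induction n arbitrary: x)
  case (Suc n)
  show ?case using Suc[of "T x"] by auto
qed simp

lemma sum_le_running_max: "(\<Sum>i<n. f ((T ^^ i) x)) \<le> running_max T f n x"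
proof (induction n arbitrary: x)
  case (Suc n)
  have "(\<Sum>i<Suc n. f ((T ^^ i) x)) = f x + (\<Sum>i<n. f ((T ^^ i) (T x)))"
    by (simp only: sum.lessThan_Suc_shift funpow_swap1) (simp add: funpow_swap1)
  with Suc[of "T x"] show ?case by simp
qed simp

lemma running_max_measurable:
  assumes [measurable]: "T \<in> M \<rightarrow>\<^sub>M M" "f \<in> borel_measurable M"
  shows "running_max T f n \<in> borel_measurable M"
proof (induction n)
  case (Suc n)
  note [measurable] = Suc
  show ?case by simp
qed simp

lemma integrable_comp_preserving:
  fixes f :: "'a \<Rightarrow> real"
  assumes "T \<in> M \<rightarrow>\<^sub>M M" "distr M M T = M" "integrable M f"
  shows "integrable M (\<lambda>x. f (T x))" "(\<integral>x. f (T x) \<partial>M) = integral\<^sup>L M f"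
  using assms integrable_distr[OF assms(1), of f] integral_distr[OF assms(1), of f] by auto

lemma running_max_integrable:
  assumes "T \<in> M \<rightarrow>\<^sub>M M" "distr M M T = M" "integrable M f"
  shows "integrable M (running_max T f n)"
proof (induction n)
  case (Suc n)
  show ?case
    using integrable_comp_preserving(1)[OF assms(1,2) Suc] assms(3) by simp
qed simp

text \<open>The maximal ergodic argument: if the running maxima \<open>m\<^sub>n\<close> were unbounded almost surely, then
  \<open>m\<^sub>n\<^sub>+\<^sub>1 - m\<^sub>n \<circ> T = max (- m\<^sub>n \<circ> T) f\<close>, whose integral is nonnegative because \<open>T\<close> preserves the
  measure, would converge to \<open>f\<close>.\<close>

lemma (in prob_space) birkhoff_sums_bounded_above:
  fixes f :: "'a \<Rightarrow> real"
  assumes T[measurable]: "T \<in> M \<rightarrow>\<^sub>M M" and pres: "distr M M T = M"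
    and erg: "\<And>A. A \<in> sets M \<Longrightarrow> T -` A \<inter> space M = A \<Longrightarrow> prob A = 0 \<or> prob A = 1"
    and int: "integrable M f" and neg: "integral\<^sup>L M f < 0"
  shows "AE x in M. \<exists>C. \<forall>n. (\<Sum>i<n. f ((T ^^ i) x)) \<le> C"
proof -
  let ?m = "running_max T f"
  have fm[measurable]: "f \<in> borel_measurable M" using int by simp
  note mm[measurable] = running_max_measurable[OF T fm]
  \<comment> \<open>Natural numbers as bounds make \<open>A\<close> a countable combination of
    measurable sets; \<open>bdd\<close> then allows real bounds.\<close>
  define A where "A = {x \<in> space M. \<not> (\<exists>C::nat. \<forall>n. ?m n x \<le> real C)}"
  have A: "A \<in> sets M" unfolding A_def by measurable
  have bdd: "(\<exists>C::nat. \<forall>n. ?m n x \<le> real C) \<longleftrightarrow> (\<exists>C. \<forall>n. ?m n x \<le> C)" for x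
    by (meson real_arch_simple order_trans)
  \<comment> \<open>The recursion links the maxima at \<open>x\<close> and at \<open>T x\<close>
    through the single finite term \<open>f x\<close>, so both are bounded or neither is. Hence
    \<open>A\<close> is invariant.\<close>
  have bddT: "(\<exists>C. \<forall>n. ?m n (T x) \<le> C) \<longleftrightarrow> (\<exists>C. \<forall>n. ?m n x \<le> C)" for x
  proof
    assume "\<exists>C. \<forall>n. ?m n (T x) \<le> C"
    then obtain C where C: "\<And>n. ?m n (T x) \<le> C" by blast
    have "?m n x \<le> max 0 (f x + C)" for n
      using C[of "n - 1"] by (cases n) auto
    then show "\<exists>C. \<forall>n. ?m n x \<le> C" by blast
  next
    assume "\<exists>C. \<forall>n. ?m n x \<le> C"
    then obtain C where C: "\<And>n. ?m n x \<le> C" by blast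
    have "?m n (T x) \<le> C - f x" for n
      using C[of "Suc n"] by auto
    then show "\<exists>C. \<forall>n. ?m n (T x) \<le> C" by blast
  qed
  have inv: "T -` A \<inter> space M = A"
    unfolding A_def bdd vimage_def using measurable_space[OF T] by (simp add: bddT del: not_ex) blast
  have "prob A \<noteq> 1"
  proof
    assume "prob A = 1"
    then have AE_A: "AE x in M. x \<in> A" using A by (simp add: prob_eq_1)
    define d where "d n x = ?m (Suc n) x - ?m n (T x)" for n x
    have d_eq: "d n x = max (- ?m n (T x)) (f x)" for n x
      unfolding d_def by auto
    have "(\<lambda>n. \<integral>x. d n x \<partial>M) \<longlonglongrightarrow> integral\<^sup>L M f"
    proof (rule integral_dominated_convergence)
      show "integrable M (\<lambda>x. \<bar>f x\<bar>)" using int by simp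
      show "AE x in M. (\<lambda>n. d n x) \<longlonglongrightarrow> f x"
        using AE_A
      proof eventually_elim
        case (elim x)
        then have "\<not> (\<exists>C. \<forall>n. ?m n (T x) \<le> C)"
          unfolding A_def bdd using bddT by auto
        \<comment> \<open>The maxima increase in \<open>n\<close>, so once \<open>?m n (T x)\<close>
          has passed \<open>- f x\<close>, the maximum in \<open>d_eq\<close> is attained by
          \<open>f x\<close> for good.\<close>
        then obtain N where N: "\<not> ?m N (T x) \<le> - f x" by blast
        have "d n x = f x" if "n \<ge> N" for n
        proof -
          have "?m N (T x) \<le> ?m n (T x)"
            using lift_Suc_mono_le[of "\<lambda>n. ?m n (T x)"] running_max_mono that by metis
          then show ?thesis using N unfolding d_eq by auto
        qed
        then have "\<forall>\<^sub>F n in sequentially. d n x = f x"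
          using eventually_sequentially by blast
        then show ?case by (rule tendsto_eventually)
      qed
      \<comment> \<open>Running maxima are nonnegative: if \<open>f x \<ge> 0\<close>, then
        \<open>d n x = f x\<close>; otherwise \<open>f x \<le> d n x \<le> 0\<close>.\<close>
      show "AE x in M. norm (d n x) \<le> \<bar>f x\<bar>" for n
        unfolding d_eq using running_max_nonneg[of T f n] by (intro always_eventually) (smt (verit) real_norm_def)
    qed (auto simp: d_def simp del: running_max.simps)
    moreover have "0 \<le> (\<integral>x. d n x \<partial>M)" for n
    proof -
      note I = running_max_integrable[OF T pres int]
      have "(\<integral>x. d n x \<partial>M) = integral\<^sup>L M (?m (Suc n)) - integral\<^sup>L M (?m n)"
        unfolding d_def
        using integrable_comp_preserving[OF T pres I[of n]] I[of "Suc n"]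
        by (simp del: running_max.simps)
      also have "\<dots> \<ge> 0"
        using integral_mono[OF I[of n] I[of "Suc n"] running_max_mono]
        by (simp del: running_max.simps)
      finally show ?thesis .
    qed
    ultimately have "0 \<le> integral\<^sup>L M f" by (simp add: LIMSEQ_le_const)
    with neg show False by simp
  qed
  with erg[OF A inv] have "prob A = 0" by blast
  then have "AE x in M. x \<notin> A" using A by (simp add: prob_eq_0)
  then show ?thesis
    using AE_space
  proof eventually_elim
    case (elim x)
    then obtain C where "\<forall>n. ?m n x \<le> C" unfolding A_def bdd by blast
    then have "(\<Sum>i<n. f ((T ^^ i) x)) \<le> C" for n
      using sum_le_running_max[of f T x n] order_trans by blast
    then show ?case by blast
  qed
qed

section \<open>Geometric decay and summability\<close>

text \<open>Adding half of the absolute mean to \<open>ln \<kappa>\<close> keeps the mean negative,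
  so the Birkhoff sums of the raised function are still bounded above. Exponentiating recovers the
  product and leaves a factor \<open>exp (- \<epsilon>)\<close> per step, which serves as the
  rate.\<close>

lemma (in prob_space) cocycle_geometric_decay:
  fixes \<kappa> :: "'a \<Rightarrow> real"
  assumes T: "T \<in> M \<rightarrow>\<^sub>M M" and pres: "distr M M T = M"
    and erg: "\<And>A. A \<in> sets M \<Longrightarrow> T -` A \<inter> space M = A \<Longrightarrow> prob A = 0 \<or> prob A = 1"
    and pos: "\<And>x. 0 < \<kappa> x"
    and int: "integrable M (\<lambda>x. ln (\<kappa> x))" and neg: "(\<integral>x. ln (\<kappa> x) \<partial>M) < 0"
  obtains r where "0 < r" "r < 1" "AE x in M. \<exists>C. \<forall>n. (\<Prod>i<n. \<kappa> ((T ^^ i) x)) \<le> C * r ^ n"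
proof -
  define \<epsilon> where "\<epsilon> = - (\<integral>x. ln (\<kappa> x) \<partial>M) / 2"
  have "\<epsilon> > 0" using neg by (simp add: \<epsilon>_def)
  let ?f = "\<lambda>x. ln (\<kappa> x) + \<epsilon>"
  have "integrable M ?f" using int by simp
  moreover have "integral\<^sup>L M ?f < 0"
    using int neg by (simp add: \<epsilon>_def prob_space)
  ultimately have "AE x in M. \<exists>C. \<forall>n. (\<Sum>i<n. ?f ((T ^^ i) x)) \<le> C"
    using birkhoff_sums_bounded_above[OF T pres erg] by blast
  then have "AE x in M. \<exists>C. \<forall>n. (\<Prod>i<n. \<kappa> ((T ^^ i) x)) \<le> C * exp (- \<epsilon>) ^ n"
  proof eventually_elim
    case (elim x)
    then obtain C where C: "\<And>n. (\<Sum>i<n. ?f ((T ^^ i) x)) \<le> C" by blast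
    have "(\<Prod>i<n. \<kappa> ((T ^^ i) x)) \<le> exp C * exp (- \<epsilon>) ^ n" for n
    proof -
      have "(\<Prod>i<n. \<kappa> ((T ^^ i) x)) = exp (\<Sum>i<n. ln (\<kappa> ((T ^^ i) x)))"
        using pos by (simp add: exp_sum)
      also have "\<dots> \<le> exp (C + real n * (- \<epsilon>))"
        using C[of n] by (simp add: sum.distrib)
      also have "\<dots> = exp C * exp (- \<epsilon>) ^ n"
        by (simp only: exp_add exp_of_nat_mult)
      finally show ?thesis .
    qed
    then show ?case by blast
  qed
  then show thesis using that[of "exp (- \<epsilon>)"] \<open>\<epsilon> > 0\<close> by simp
qed

text \<open>The integral of the series is at most \<open>max 0 c / (1 - r)\<close>, so the series is
  finite almost everywhere. Geometric decay thus absorbs random terms with uniformly bounded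
  means.\<close>

lemma AE_summable_geometric:
  fixes Y :: "nat \<Rightarrow> 'a \<Rightarrow> real"
  assumes [measurable]: "\<And>n. Y n \<in> borel_measurable M" and nonneg: "\<And>n x. 0 \<le> Y n x"
    and bound: "\<And>n. (\<integral>\<^sup>+x. ennreal (Y n x) \<partial>M) \<le> ennreal c"
    and r: "0 < r" "r < 1"
  shows "AE x in M. summable (\<lambda>n. r ^ n * Y n x)"
proof -
  have "(\<integral>\<^sup>+x. (\<Sum>n. ennreal (r ^ n * Y n x)) \<partial>M) = (\<Sum>n. \<integral>\<^sup>+x. ennreal (r ^ n * Y n x) \<partial>M)"
    by (rule nn_integral_suminf) measurable
  \<comment> \<open>\<open>ennreal\<close> sends a negative \<open>c\<close> to 0;
    \<open>max 0 c\<close> has the same image and, being nonnegative, lets \<open>ennreal\<close> be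
    multiplicative.\<close>
  also have "\<dots> \<le> (\<Sum>n. ennreal (r ^ n * max 0 c))"
  proof (rule suminf_le)
    fix n
    have "(\<integral>\<^sup>+x. ennreal (r ^ n * Y n x) \<partial>M) = ennreal (r ^ n) * (\<integral>\<^sup>+x. ennreal (Y n x) \<partial>M)"
      using r nonneg by (simp add: ennreal_mult nn_integral_cmult)
    also have "\<dots> \<le> ennreal (r ^ n) * ennreal (max 0 c)"
      using bound[of n] by (intro mult_left_mono) (auto intro: order_trans ennreal_leI)
    finally show "(\<integral>\<^sup>+x. ennreal (r ^ n * Y n x) \<partial>M) \<le> ennreal (r ^ n * max 0 c)"
      using r by (simp add: ennreal_mult)
  qed auto
  also have "\<dots> < \<infinity>"
    using r by (simp add: suminf_ennreal_eq[OF _ sums_mult2[OF geometric_sums[of r]]])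
  finally have "AE x in M. (\<Sum>n. ennreal (r ^ n * Y n x)) \<noteq> \<infinity>"
    by (intro nn_integral_PInf_AE) auto
  then show ?thesis
    by eventually_elim (rule summable_suminf_not_top, use r nonneg in auto)
qed

section \<open>Truncation of the logarithm\<close>

text \<open>The thresholds \<open>exp (- real n)\<close> are at most 1, so truncation leaves the
  positive part of the logarithm unchanged, while the truncated negative parts increase to the full
  one. By monotone convergence their integrals eventually exceed that of the positive part, also
  when the mean is -\<infinity>.\<close>

lemma (in prob_space) truncated_log_mean_negative:
  fixes k :: "'a \<Rightarrow> real"
  assumes [measurable]: "k \<in> borel_measurable M" and nonneg: "\<And>x. 0 \<le> k x"
    and neg: "eexpectation M (\<lambda>x. elog (k x)) < 0"
  obtains \<delta> where "0 < \<delta>" "integrable M (\<lambda>x. ln (max (k x) \<delta>))" "(\<integral>x. ln (max (k x) \<delta>) \<partial>M) < 0"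
proof -
  define f where "f n x = ln (max (k x) (exp (- real n)))" for n x
  have [measurable]: "f n \<in> borel_measurable M" for n unfolding f_def by measurable
  define p where "p = (\<integral>\<^sup>+x. e2ennreal (elog (k x)) \<partial>M)"
  define q where "q = (\<integral>\<^sup>+x. e2ennreal (- elog (k x)) \<partial>M)"
  have fge: "f n x \<ge> - real n" for n x
    unfolding f_def by (subst ln_ge_iff) (auto simp: less_max_iff_disj)
  have p_eq: "ennreal (f n x) = e2ennreal (elog (k x))" for n x
  proof (cases "k x \<le> exp (- real n)")
    case True
    then have "k x \<le> 1" by (rule order_trans) simp
    then have "elog (k x) \<le> 0" using nonneg[of x] by (auto simp: elog_def)
    moreover have "f n x \<le> 0" using True by (simp add: f_def max_def)
    ultimately show ?thesis by (simp add: e2ennreal_neg ennreal_neg)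
  next
    case False
    moreover have "k x > 0" using False by (meson exp_gt_zero less_trans not_le)
    ultimately show ?thesis by (simp add: f_def elog_def max_def)
  qed
  have q_sup: "(SUP n. ennreal (- f n x)) = e2ennreal (- elog (k x))" for x
  proof (cases "k x = 0")
    case True
    \<comment> \<open>The truncated logarithm of 0 is \<open>- real n\<close>; the supremum of its
      negatives is \<infinity>, in agreement with \<open>elog 0 = -\<infinity>\<close>.\<close>
    then have "ennreal (- f n x) = of_nat n" for n by (simp add: f_def max_def ennreal_of_nat_eq_real_of_nat)
    then show ?thesis using True by (simp add: elog_def ennreal_SUP_of_nat_eq_top)
  next
    case False
    then have pos: "k x > 0" using nonneg[of x] by simp
    have le: "ennreal (- f n x) \<le> ennreal (- ln (k x))" for n
      unfolding f_def using pos by (intro ennreal_leI) (auto simp: max_def)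
    obtain N :: nat where "- ln (k x) \<le> real N" using real_arch_simple by blast
    then have "exp (- real N) \<le> k x"
      using pos by (metis exp_le_cancel_iff exp_ln minus_le_iff)
    then have "f N x = ln (k x)" by (simp add: f_def max_def)
    then have "(SUP n. ennreal (- f n x)) = ennreal (- ln (k x))"
      using le by (intro antisym SUP_least SUP_upper2[of N]) auto
    then show ?thesis using pos by (simp add: elog_def)
  qed
  have "p < q"
  proof (rule ccontr)
    assume "\<not> p < q"
    then have "enn2ereal q \<le> enn2ereal p" by (simp add: less_eq_ennreal.rep_eq[symmetric])
    \<comment> \<open>If both parts are infinite, the difference is \<infinity> by convention, so
      this case is contradictory too.\<close>
    then have "0 \<le> enn2ereal p - enn2ereal q"
      by (cases "enn2ereal p"; cases "enn2ereal q") auto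
    with neg show False by (simp add: eexpectation_def p_def q_def)
  qed
  also have "q = (SUP n. \<integral>\<^sup>+x. ennreal (- f n x) \<partial>M)"
    unfolding q_def q_sup[symmetric]
  proof (rule nn_integral_monotone_convergence_SUP)
    have "f n x \<le> f m x" if "m \<le> n" for m n x
      unfolding f_def using that by (intro ln_mono max.mono) (auto simp: less_max_iff_disj)
    then show "incseq (\<lambda>n x. ennreal (- f n x))"
      by (auto simp: incseq_def le_fun_def intro!: ennreal_leI)
  qed simp
  finally obtain n where n: "p < (\<integral>\<^sup>+x. ennreal (- f n x) \<partial>M)"
    by (auto simp: less_SUP_iff)
  have p_int: "(\<integral>\<^sup>+x. ennreal (f n x) \<partial>M) = p" by (simp add: p_def p_eq)
  \<comment> \<open>The truncation bounds the negative part by \<open>n\<close>; the positive part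
    \<open>p\<close> lies strictly below its integral, so both are finite.\<close>
  have "(\<integral>\<^sup>+x. ennreal (- f n x) \<partial>M) \<le> (\<integral>\<^sup>+x. ennreal (real n) \<partial>M)"
    using fge[of n] by (intro nn_integral_mono ennreal_leI) (auto simp: minus_le_iff)
  then have q_fin: "(\<integral>\<^sup>+x. ennreal (- f n x) \<partial>M) < \<infinity>"
    by (simp add: emeasure_space_1 le_less_trans)
  then have int: "integrable M (f n)"
    using n p_int by (auto simp: real_integrable_def)
  have "integral\<^sup>L M (f n) < 0"
    using n q_fin p_int by (simp add: real_lebesgue_integral_def[OF int] enn2real_less_iff less_top)
  with int show thesis using that[of "exp (- real n)"] unfolding f_def by simp
qed

section \<open>Shifts on path space and stationary codings\<close>

definition back_shift :: "(int \<Rightarrow> 'c) \<Rightarrow> int \<Rightarrow> 'c" where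
  "back_shift w = (\<lambda>i. w (i - 1))"

lemma back_shift_shift [simp]: "back_shift (shift w) = w" "shift (back_shift w) = w"
  by (auto simp: back_shift_def shift_def)

lemma funpow_shift: "(shift ^^ n) w = (\<lambda>i. w (i + of_nat n))"
  by (induction n) (auto simp: shift_def add_ac)

lemma funpow_back_shift: "(back_shift ^^ n) w = (\<lambda>i. w (i - int n))"
  by (induction n) (auto simp: back_shift_def algebra_simps)

lemma translate_measurable:
  "(\<lambda>w i. w (f i)) \<in> (path_space :: ('i \<Rightarrow> 'c::topological_space) measure) \<rightarrow>\<^sub>M (path_space :: ('j \<Rightarrow> 'c) measure)"
  by (rule measurable_PiM_single') (auto simp: space_PiM)

lemma shift_measurable: "shift \<in> path_space \<rightarrow>\<^sub>M path_space"
  unfolding shift_def[abs_def] by (rule translate_measurable)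

lemma back_shift_measurable: "back_shift \<in> path_space \<rightarrow>\<^sub>M path_space"
  unfolding back_shift_def[abs_def] by (rule translate_measurable)

lemma space_path_space: "space path_space = UNIV"
  by (simp add: space_PiM)

lemma path_measurable:
  assumes "\<And>i. Y i \<in> borel_measurable M"
  shows "(\<lambda>\<omega> i. Y i \<omega>) \<in> M \<rightarrow>\<^sub>M path_space"
  using assms by (intro measurable_PiM_single') (auto simp: space_PiM)

lemma stationary_measurable: "stationary M Y \<Longrightarrow> Y i \<in> borel_measurable M"
  by (simp add: stationary_def)

lemma path_law_translate:
  assumes "stationary M Y"
  shows "distr (path_law M Y) path_space (\<lambda>w i. w (i + h)) = path_law M Y"
proof -
  have "distr (path_law M Y) path_space (\<lambda>w i. w (i + h)) = path_law M (\<lambda>i. Y (i + h))"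
    unfolding path_law_def
    by (subst distr_distr[OF translate_measurable path_measurable])
       (auto simp: comp_def intro: stationary_measurable[OF assms])
  also have "\<dots> = path_law M Y" using assms by (simp add: stationary_def)
  finally show ?thesis .
qed

lemma path_law_shift: "stationary M Y \<Longrightarrow> distr (path_law M Y) path_space shift = path_law M Y"
  unfolding shift_def[abs_def] by (rule path_law_translate)

lemma path_law_back_shift:
  "stationary M Y \<Longrightarrow> distr (path_law M Y) path_space back_shift = path_law M Y"
  using path_law_translate[of M Y "-1"] by (simp add: back_shift_def[abs_def])

lemma nn_integral_path_law_coordinate:
  fixes i j :: int
  assumes "stationary M Y" and "u \<in> borel_measurable borel"
  shows "(\<integral>\<^sup>+w. u (w i) \<partial>path_law M Y) = (\<integral>\<^sup>+w. u (w j) \<partial>path_law M Y)"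
proof -
  have "(\<integral>\<^sup>+w. u (w i) \<partial>path_law M Y)
      = (\<integral>\<^sup>+w. u (w i) \<partial>distr (path_law M Y) path_space (\<lambda>w k. w (k + (j - i))))"
    by (simp only: path_law_translate[OF assms(1)])
  also have "\<dots> = (\<integral>\<^sup>+w. u (w j) \<partial>path_law M Y)"
    by (subst nn_integral_distr) (use assms(2) in \<open>auto simp: path_law_def intro: translate_measurable\<close>)
  finally show ?thesis .
qed

text \<open>The map \<open>\<Psi>\<close> from two-sided to one-sided paths intertwines the shifts
  and pushes the law of \<open>Z\<close> to the law of \<open>X\<close>. An invariant set therefore
  pulls back to an invariant set of the same measure.\<close>

lemma stationary_ergodic_factor:
  fixes Z :: "int \<Rightarrow> 'a \<Rightarrow> 'c::topological_space" and X :: "nat \<Rightarrow> 'a \<Rightarrow> 'b::topological_space"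
  assumes Z: "stationary_ergodic M Z"
    and g: "g \<in> borel_measurable path_space"
    and X: "\<And>n. X n \<in> borel_measurable M"
    and coding: "AE \<omega> in M. \<forall>n. X n \<omega> = g ((shift ^^ n) (\<lambda>i. Z i \<omega>))"
  shows "stationary_ergodic M X"
proof -
  define \<Psi> where "\<Psi> w = (\<lambda>n. g ((shift ^^ n) w))" for w
  have st: "stationary M Z" using Z by (simp add: stationary_ergodic_def)
  note Zm = path_measurable[OF stationary_measurable[OF st]]
  have \<Psi>: "\<Psi> \<in> path_space \<rightarrow>\<^sub>M path_space"
    unfolding \<Psi>_def funpow_shift
    by (intro path_measurable measurable_compose[OF translate_measurable g])
  \<comment> \<open>The right-hand side is free of \<open>h\<close>, so this identity contains
    stationarity; \<open>h = 0\<close> identifies the law itself.\<close>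
  have law: "path_law M (\<lambda>i. X (i + h)) = distr (path_law M Z) path_space \<Psi>" for h
  proof -
    have "path_law M (\<lambda>i. X (i + h)) = distr M path_space (\<lambda>\<omega>. \<Psi> (\<lambda>i. Z (i + int h) \<omega>))"
      unfolding path_law_def
    proof (rule distr_cong_AE)
      show "AE \<omega> in M. (\<lambda>i. X (i + h) \<omega>) = \<Psi> (\<lambda>i. Z (i + int h) \<omega>)"
        using coding
        by eventually_elim (auto simp: \<Psi>_def funpow_shift fun_eq_iff algebra_simps)
      show "(\<lambda>\<omega> i. X (i + h) \<omega>) \<in> M \<rightarrow>\<^sub>M path_space" by (intro path_measurable X)
      show "(\<lambda>\<omega>. \<Psi> (\<lambda>i. Z (i + int h) \<omega>)) \<in> M \<rightarrow>\<^sub>M path_space"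
        by (rule measurable_compose[OF path_measurable \<Psi>]) (rule stationary_measurable[OF st])
    qed auto
    also have "\<dots> = distr (path_law M (\<lambda>i. Z (i + int h))) path_space \<Psi>"
      unfolding path_law_def
      by (subst distr_distr[OF \<Psi> path_measurable])
         (auto simp: comp_def intro: stationary_measurable[OF st])
    also have "path_law M (\<lambda>i. Z (i + int h)) = path_law M Z"
      using st by (simp add: stationary_def)
    finally show ?thesis .
  qed
  have law0: "path_law M X = distr (path_law M Z) path_space \<Psi>"
    using law[of 0] by simp
  have "measure (path_law M X) A = 0 \<or> measure (path_law M X) A = 1"
    if A: "A \<in> sets path_space" and inv: "shift -` A = A" for A
  proof -
    have "\<Psi> (shift w) = shift (\<Psi> w)" for w
      by (simp add: \<Psi>_def shift_def[of "\<lambda>n. g ((shift ^^ n) w)"] funpow_swap1)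
    then have "shift -` (\<Psi> -` A) = \<Psi> -` (shift -` A)" by auto
    then have "shift -` (\<Psi> -` A) = \<Psi> -` A" by (simp only: inv)
    moreover have "\<Psi> -` A \<in> sets path_space"
      using measurable_sets[OF \<Psi> A] by (simp add: space_path_space)
    moreover have "measure (path_law M X) A = measure (path_law M Z) (\<Psi> -` A)"
      unfolding law0 using \<Psi> A
      by (subst measure_distr) (auto simp: path_law_def space_path_space)
    ultimately show ?thesis using Z by (simp add: stationary_ergodic_def)
  qed
  then show ?thesis
    unfolding stationary_ergodic_def stationary_def using X law law0 by auto
qed

section \<open>Iterates started in the distant past\<close>

text \<open>This is the state at time 0 of the recursion started from 0 at time -m and driven by the
  inputs at times 1 - m, ..., 0.\<close>

primrec pullback :: "('b \<Rightarrow> 'c \<Rightarrow> 'b) \<Rightarrow> nat \<Rightarrow> (int \<Rightarrow> 'c) \<Rightarrow> 'b::zero" where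
  "pullback F 0 w = 0"
| "pullback F (Suc m) w = F (pullback F m (back_shift w)) (w 0)"

text \<open>\<open>lim\<close> has a fixed value on divergent paths, so the function is defined and
  measurable on the whole path space, though a genuine limit only on convergent paths.\<close>

definition pullback_limit :: "('b \<Rightarrow> 'c \<Rightarrow> 'b) \<Rightarrow> (int \<Rightarrow> 'c) \<Rightarrow> 'b::{zero,t2_space}" where
  "pullback_limit F w = lim (\<lambda>m. pullback F m w)"

lemma pullback_measurable:
  fixes F :: "'b::{zero,topological_space} \<Rightarrow> 'c::topological_space \<Rightarrow> 'b"
  assumes F: "(\<lambda>(x, z). F x z) \<in> borel \<Otimes>\<^sub>M borel \<rightarrow>\<^sub>M borel"
  shows "pullback F m \<in> borel_measurable path_space"
proof (induction m)
  case (Suc m)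
  have "(\<lambda>w. (pullback F m (back_shift w), w 0)) \<in> path_space \<rightarrow>\<^sub>M borel \<Otimes>\<^sub>M borel"
    by (intro measurable_Pair measurable_compose[OF back_shift_measurable Suc]) auto
  from measurable_compose[OF this F] show ?case by simp
qed simp

lemma pullback_limit_measurable:
  fixes F :: "'b::{banach,second_countable_topology} \<Rightarrow> 'c::topological_space \<Rightarrow> 'b"
  assumes "(\<lambda>(x, z). F x z) \<in> borel \<Otimes>\<^sub>M borel \<rightarrow>\<^sub>M borel"
  shows "pullback_limit F \<in> borel_measurable path_space"
  unfolding pullback_limit_def[abs_def]
  by (intro borel_measurable_lim_metric pullback_measurable[OF assms])

section \<open>Consequences of the Lipschitz bound\<close>

context
  fixes F :: "'b::real_normed_vector \<Rightarrow> 'c \<Rightarrow> 'b" and \<kappa> :: "'c \<Rightarrow> real"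
  assumes lipschitz: "\<And>x x' z. norm (F x z - F x' z) \<le> \<kappa> z * norm (x - x')"
    and \<kappa>_nonneg: "\<And>z. 0 \<le> \<kappa> z"
begin

text \<open>At time -m the longer run is in state \<open>F 0 (w (- int m))\<close> and the shorter
  one in 0. Both then pass through the same \<open>m\<close> maps, each of which contributes one
  Lipschitz factor.\<close>

lemma pullback_increment:
  "norm (pullback F (Suc m) w - pullback F m w)
    \<le> (\<Prod>i<m. \<kappa> (w (- int i))) * norm (F 0 (w (- int m)))"
proof (induction m arbitrary: w)
  case (Suc m)
  have "norm (pullback F (Suc (Suc m)) w - pullback F (Suc m) w)
      \<le> \<kappa> (w 0) * norm (pullback F (Suc m) (back_shift w) - pullback F m (back_shift w))"
    unfolding pullback.simps(2)[of F "Suc m" w] pullback.simps(2)[of F m w] by (rule lipschitz)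
  also have "\<dots> \<le> \<kappa> (w 0) * ((\<Prod>i<m. \<kappa> (back_shift w (- int i))) * norm (F 0 (back_shift w (- int m))))"
    by (intro mult_left_mono Suc \<kappa>_nonneg)
  also have "\<dots> = (\<Prod>i<Suc m. \<kappa> (w (- int i))) * norm (F 0 (w (- int (Suc m))))"
  proof -
    \<comment> \<open>Splitting off the factor at time 0 leaves the others one unit further back, as
      read off by \<open>back_shift\<close>.\<close>
    have "- int (Suc i) = - int i - 1" for i by simp
    then show ?thesis
      unfolding prod.lessThan_Suc_shift back_shift_def by (simp only: mult_ac of_nat_0 minus_zero)
  qed
  finally show ?case .
qed simp

lemma driven_process_contraction:
  "norm (driven_process F Z V n \<omega> - driven_process F Z V' n \<omega>)
    \<le> (\<Prod>i<n. \<kappa> (Z (int i + 1) \<omega>)) * norm (V \<omega> - V' \<omega>)"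
proof (induction n)
  case (Suc n)
  have "norm (driven_process F Z V (Suc n) \<omega> - driven_process F Z V' (Suc n) \<omega>)
     \<le> \<kappa> (Z (int n + 1) \<omega>) * norm (driven_process F Z V n \<omega> - driven_process F Z V' n \<omega>)"
    by (simp add: lipschitz)
  also have "\<dots> \<le> \<kappa> (Z (int n + 1) \<omega>) * ((\<Prod>i<n. \<kappa> (Z (int i + 1) \<omega>)) * norm (V \<omega> - V' \<omega>))"
    by (intro mult_left_mono Suc \<kappa>_nonneg)
  finally show ?case by (simp add: mult_ac)
qed simp

text \<open>\<open>pullback F (Suc m) (shift w)\<close> equals
  \<open>F (pullback F m w) (w 1)\<close>, and the Lipschitz bound makes \<open>F\<close> continuous
  in the state. Convergence thus propagates one time step forward.\<close>

lemma pullback_shift_tendsto: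
  assumes "convergent (\<lambda>m. pullback F m w)"
  shows "(\<lambda>m. pullback F m (shift w)) \<longlonglongrightarrow> F (pullback_limit F w) (w 1)"
proof -
  have "(\<lambda>m. pullback F m w) \<longlonglongrightarrow> pullback_limit F w"
    using assms by (simp add: pullback_limit_def convergent_LIMSEQ_iff)
  then have "(\<lambda>m. norm (pullback F m w - pullback_limit F w)) \<longlonglongrightarrow> 0"
    by (simp add: LIM_zero tendsto_norm_zero)
  then have "(\<lambda>m. \<kappa> (w 1) * norm (pullback F m w - pullback_limit F w)) \<longlonglongrightarrow> 0"
    by (rule tendsto_mult_right_zero)
  then have "(\<lambda>m. F (pullback F m w) (w 1) - F (pullback_limit F w) (w 1)) \<longlonglongrightarrow> 0"
    by (rule Lim_null_comparison[rotated]) (simp add: lipschitz)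
  moreover have "shift w 0 = w 1" by (simp add: shift_def)
  ultimately have "(\<lambda>m. pullback F (Suc m) (shift w)) \<longlonglongrightarrow> F (pullback_limit F w) (w 1)"
    by (simp add: LIM_zero_iff)
  then show ?thesis by (rule LIMSEQ_imp_Suc)
qed

lemma driven_process_pullback_limit:
  assumes "convergent (\<lambda>m. pullback F m (\<lambda>i. Z i \<omega>))" and "V \<omega> = pullback_limit F (\<lambda>i. Z i \<omega>)"
  shows "driven_process F Z V n \<omega> = pullback_limit F ((shift ^^ n) (\<lambda>i. Z i \<omega>))"
proof -
  \<comment> \<open>Convergence along the shifted path is part of the induction, because the next
    step starts from it.\<close>
  have "convergent (\<lambda>m. pullback F m ((shift ^^ n) (\<lambda>i. Z i \<omega>))) \<and>
    driven_process F Z V n \<omega> = pullback_limit F ((shift ^^ n) (\<lambda>i. Z i \<omega>))"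
  proof (induction n)
    case (Suc n)
    let ?w = "(shift ^^ n) (\<lambda>i. Z i \<omega>)"
    have "(\<lambda>m. pullback F m (shift ?w)) \<longlonglongrightarrow> F (pullback_limit F ?w) (?w 1)"
      using Suc by (intro pullback_shift_tendsto) simp
    moreover have "?w 1 = Z (int n + 1) \<omega>" by (simp add: funpow_shift add.commute)
    ultimately show ?case
      using Suc by (auto simp: pullback_limit_def convergent_def limI)
  qed (simp add: assms)
  then show ?thesis ..
qed

end

lemma driven_process_measurable:
  fixes F :: "'b::topological_space \<Rightarrow> 'c::topological_space \<Rightarrow> 'b"
  assumes F: "(\<lambda>(x, z). F x z) \<in> borel \<Otimes>\<^sub>M borel \<rightarrow>\<^sub>M borel"
    and Z: "\<And>i. Z i \<in> borel_measurable M" and V: "V \<in> borel_measurable M"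
  shows "driven_process F Z V n \<in> borel_measurable M"
proof (induction n)
  case (Suc n)
  have "(\<lambda>\<omega>. (driven_process F Z V n \<omega>, Z (int n + 1) \<omega>)) \<in> M \<rightarrow>\<^sub>M borel \<Otimes>\<^sub>M borel"
    by (intro measurable_Pair Suc Z)
  from measurable_compose[OF this F] show ?case by simp
qed (simp add: V)

lemma convergent_of_summable_increments:
  fixes u :: "nat \<Rightarrow> 'b::real_normed_vector"
  assumes "summable (\<lambda>n. u (Suc n) - u n)"
  shows "convergent u"
proof -
  have "convergent (\<lambda>n. u n - u 0)"
    using assms by (simp add: summable_iff_convergent sum_lessThan_telescope)
  then show ?thesis by (simp add: convergent_diff_const_right_iff)
qed

section \<open>Strong stability of the driven process\<close>

theorem proposition1:
  fixes M :: "'a measure"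
    and Z :: "int \<Rightarrow> 'a \<Rightarrow> real ^ 'k"
    and \<mu> :: "(real ^ 'k) measure"
    and F :: "real ^ 'd \<Rightarrow> real ^ 'k \<Rightarrow> real ^ 'd"
    and K :: "real ^ 'k \<Rightarrow> real"
  assumes "prob_space M"
    and "stationary_ergodic M Z"
    and "\<mu> = distr M borel (Z 1)"
    and "(\<lambda>(x, z). F x z) \<in> borel \<Otimes>\<^sub>M borel \<rightarrow>\<^sub>M borel"
    and "(\<integral>\<^sup>+ z. ennreal (norm (F 0 z)) \<partial>\<mu>) < \<infinity>"
    and "K \<in> borel_measurable borel"
    and "\<And>z. 0 \<le> K z"
    and "\<And>x x' z. norm (F x z - F x' z) \<le> K z * norm (x - x')"
    and "eexpectation M (\<lambda>\<omega>. elog (K (Z 1 \<omega>))) < 0"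
  shows "strongly_stable M (driven_process F Z)"
proof -
  interpret prob_space M by fact
  have st: "stationary M Z" using assms(2) by (simp add: stationary_ergodic_def)
  note Zm[measurable] = stationary_measurable[OF st]
  note paths = path_measurable[of Z, OF Zm]
  note F_meas = assms(4)
  \<comment> \<open>The shift acts on paths rather than on the points of \<open>M\<close>, so the
    ergodic lemmas are applied to the path law; \<open>AE_distrD\<close> carries their conclusions
    back to \<open>M\<close>.\<close>
  define P where "P = path_law M Z"
  interpret P: prob_space P
    unfolding P_def path_law_def by (rule prob_space_distr[OF paths])
  have sets_P[measurable_cong]: "sets P = sets path_space" by (simp add: P_def path_law_def)
  have space_P: "space P = UNIV" by (simp add: P_def path_law_def space_path_space)
  have distr_P: "distr P P T = distr P path_space T" for T
    by (rule distr_cong[OF refl sets_P refl])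
  have shift_P: "shift \<in> P \<rightarrow>\<^sub>M P" "distr P P shift = P"
    using shift_measurable path_law_shift[OF st] measurable_cong_sets[OF sets_P sets_P]
    unfolding distr_P by (auto simp: P_def)
  have back_P: "back_shift \<in> P \<rightarrow>\<^sub>M P" "distr P P back_shift = P"
    using back_shift_measurable path_law_back_shift[OF st] measurable_cong_sets[OF sets_P sets_P]
    unfolding distr_P by (auto simp: P_def)
  have erg_shift: "P.prob A = 0 \<or> P.prob A = 1" if "A \<in> sets P" "shift -` A \<inter> space P = A" for A
    using that assms(2) unfolding stationary_ergodic_def by (simp add: sets_P space_P flip: P_def)
  have erg_back: "P.prob A = 0 \<or> P.prob A = 1"
    if A: "A \<in> sets P" "back_shift -` A \<inter> space P = A" for A
  proof (rule erg_shift[OF A(1)])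
    \<comment> \<open>The two shifts are inverse to each other, so a set invariant under one is
      invariant under the other.\<close>
    have "shift -` (back_shift -` A) = A" by (simp add: vimage_def)
    then show "shift -` A \<inter> space P = A" using A(2) by (simp add: space_P)
  qed

  note [measurable] = assms(6)
  have "(\<lambda>\<omega>. K (Z 1 \<omega>)) \<in> borel_measurable M" by measurable
  from truncated_log_mean_negative[OF this assms(7) assms(9)]
  obtain \<delta> where \<delta>: "0 < \<delta>" "integrable M (\<lambda>\<omega>. ln (max (K (Z 1 \<omega>)) \<delta>))"
      "(\<integral>\<omega>. ln (max (K (Z 1 \<omega>)) \<delta>) \<partial>M) < 0" .
  \<comment> \<open>Raising \<open>K\<close> to at least \<open>\<delta>\<close> preserves the
    Lipschitz bound and makes every factor positive, as \<open>cocycle_geometric_decay\<close>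
    requires.\<close>
  define \<kappa> where "\<kappa> z = max (K z) \<delta>" for z
  have [measurable]: "\<kappa> \<in> borel_measurable borel" unfolding \<kappa>_def[abs_def] by measurable
  have \<kappa>_pos: "0 < \<kappa> z" for z using \<delta>(1) by (simp add: \<kappa>_def less_max_iff_disj)
  then have \<kappa>_nonneg: "0 \<le> \<kappa> z" for z by (rule less_imp_le)
  have lip: "norm (F x z - F x' z) \<le> \<kappa> z * norm (x - x')" for x x' z
    using assms(8)[of x z x'] by (rule order_trans) (auto simp: \<kappa>_def intro: mult_right_mono)
  have meas1: "(\<lambda>w. ln (\<kappa> (w (1::int)))) \<in> borel_measurable path_space" by measurable
  have int1: "integrable P (\<lambda>w. ln (\<kappa> (w 1)))" and neg1: "(\<integral>w. ln (\<kappa> (w 1)) \<partial>P) < 0"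
    unfolding P_def path_law_def using \<delta>(2,3)[folded \<kappa>_def]
    by (simp_all add: integrable_distr_eq[OF paths meas1] integral_distr[OF paths meas1])
  \<comment> \<open>Since \<open>back_shift w 1 = w 0\<close>, invariance of \<open>P\<close> moves
    the moment from time 1 to time 0. Forward products begin with \<open>w 1\<close>, the first
    input after time 0; backward ones begin with \<open>w 0\<close>, the last input that
    \<open>pullback\<close> uses.\<close>
  have int0: "integrable P (\<lambda>w. ln (\<kappa> (w 0)))" and neg0: "(\<integral>w. ln (\<kappa> (w 0)) \<partial>P) < 0"
    using integrable_comp_preserving[OF back_P int1] neg1 by (simp_all add: back_shift_def)

  obtain r where r: "0 < r" "r < 1"
    and fwd: "AE w in P. \<exists>C. \<forall>n. (\<Prod>i<n. \<kappa> ((shift ^^ i) w 1)) \<le> C * r ^ n"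
    using P.cocycle_geometric_decay[OF shift_P erg_shift \<kappa>_pos int1 neg1] by blast
  obtain s where s: "0 < s" "s < 1"
    and bwd: "AE w in P. \<exists>C. \<forall>n. (\<Prod>i<n. \<kappa> ((back_shift ^^ i) w 0)) \<le> C * s ^ n"
    using P.cocycle_geometric_decay[OF back_P erg_back \<kappa>_pos int0 neg0] by blast

  have F0[measurable]: "F 0 \<in> borel_measurable borel"
    using measurable_compose[OF measurable_Pair1' F_meas, of 0] by simp
  define c where "c = (\<integral>\<^sup>+ z. ennreal (norm (F 0 z)) \<partial>\<mu>)"
  have c: "c = ennreal (enn2real c)" using assms(5) by (simp add: c_def)
  have "(\<integral>\<^sup>+w. ennreal (norm (F 0 (w (- int n)))) \<partial>P) = c" for n
  proof -
    have "(\<integral>\<^sup>+w. ennreal (norm (F 0 (w (- int n)))) \<partial>P) = (\<integral>\<^sup>+w. ennreal (norm (F 0 (w 1))) \<partial>P)"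
      unfolding P_def by (rule nn_integral_path_law_coordinate[OF st]) measurable
    also have "\<dots> = (\<integral>\<^sup>+\<omega>. ennreal (norm (F 0 (Z 1 \<omega>))) \<partial>M)"
      unfolding P_def path_law_def by (rule nn_integral_distr[OF paths]) measurable
    also have "\<dots> = c"
      unfolding c_def assms(3) by (rule nn_integral_distr[symmetric]) measurable
    finally show ?thesis .
  qed
  \<comment> \<open>By stationarity all these norms have the same finite mean, so weights decaying
    at the backward rate \<open>s\<close> make the series converge. It dominates the pullback
    increments.\<close>
  then have "AE w in P. summable (\<lambda>n. s ^ n * norm (F 0 (w (- int n))))"
    using c by (intro AE_summable_geometric[where c = "enn2real c"] s) auto
  with bwd have conv_P: "AE w in P. convergent (\<lambda>m. pullback F m w)"
  proof eventually_elim
    case (elim w)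
    then obtain C where C: "\<And>n. (\<Prod>i<n. \<kappa> (w (- int i))) \<le> C * s ^ n"
      by (auto simp: funpow_back_shift)
    have "norm (pullback F (Suc n) w - pullback F n w) \<le> C * (s ^ n * norm (F 0 (w (- int n))))" for n
      using pullback_increment[of F \<kappa>, OF lip \<kappa>_nonneg, of n w]
        mult_right_mono[OF C[of n] norm_ge_zero, of "F 0 (w (- int n))"] by (simp add: mult_ac)
    then have "summable (\<lambda>n. pullback F (Suc n) w - pullback F n w)"
      by (intro summable_comparison_test'[OF summable_mult[OF elim(2), of C]])
    then show ?case by (rule convergent_of_summable_increments)
  qed
  have conv: "AE \<omega> in M. convergent (\<lambda>m. pullback F m (\<lambda>i. Z i \<omega>))"
    using AE_distrD[OF paths] conv_P unfolding P_def path_law_def by blast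

  define V' where "V' \<omega> = pullback_limit F (\<lambda>i. Z i \<omega>)" for \<omega>
  have V': "V' \<in> borel_measurable M"
    unfolding V'_def[abs_def] by (rule measurable_compose[OF paths pullback_limit_measurable[OF F_meas]])
  \<comment> \<open>Off a single null set, the process started from \<open>V'\<close> is the coding
    of \<open>Z\<close> by \<open>pullback_limit F\<close> at all times at once, which is the form
    \<open>stationary_ergodic_factor\<close> takes.\<close>
  have "AE \<omega> in M. \<forall>n. driven_process F Z V' n \<omega> = pullback_limit F ((shift ^^ n) (\<lambda>i. Z i \<omega>))"
    using conv
  proof eventually_elim
    case (elim \<omega>)
    show ?case
      using driven_process_pullback_limit[of F \<kappa> Z \<omega> V', OF lip \<kappa>_nonneg elim V'_def] by blast
  qed
  then have se: "stationary_ergodic M (driven_process F Z V')"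
    by (intro stationary_ergodic_factor[OF assms(2) pullback_limit_measurable[OF F_meas]]
        driven_process_measurable F_meas Zm V')

  have fwd_M: "AE \<omega> in M. \<exists>C. \<forall>n. (\<Prod>i<n. \<kappa> (Z (int i + 1) \<omega>)) \<le> C * r ^ n"
    using AE_distrD[OF paths fwd[unfolded P_def path_law_def]]
    by (simp add: funpow_shift add.commute)
  \<comment> \<open>The contraction is pathwise, with the initial distance
    \<open>norm (V \<omega> - V' \<omega>)\<close> constant in \<open>n\<close>; this is how
    \<open>V\<close> may depend on the entire trajectory.\<close>
  have "AE \<omega> in M. (\<lambda>n. driven_process F Z V n \<omega> - driven_process F Z V' n \<omega>) \<longlonglongrightarrow> 0" for V
    using fwd_M
  proof eventually_elim
    case (elim \<omega>)
    then obtain C where C: "\<And>n. (\<Prod>i<n. \<kappa> (Z (int i + 1) \<omega>)) \<le> C * r ^ n" by blast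
    have "norm (driven_process F Z V n \<omega> - driven_process F Z V' n \<omega>)
        \<le> C * r ^ n * norm (V \<omega> - V' \<omega>)" for n
      using driven_process_contraction[of F \<kappa>, OF lip \<kappa>_nonneg]
        mult_right_mono[OF C norm_ge_zero] by (rule order_trans)
    moreover have "(\<lambda>n. C * r ^ n * norm (V \<omega> - V' \<omega>)) \<longlonglongrightarrow> 0"
      using r by (intro tendsto_mult_left_zero tendsto_mult_right_zero LIMSEQ_power_zero) simp
    ultimately show ?case
      by (rule Lim_null_comparison[OF always_eventually[OF allI]])
  qed
  with V' se show ?thesis unfolding strongly_stable_def by blast
qed

end
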